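(* Let $S=\langle n_1,n_2,n_3\rangle$ be a numerical semigroup with three minimal generators. Then $\operatorname{LD}(S)$ occurs at a Betti element; that is, there exists $b\in\operatorname{Betti}(S)$ with $|\mathsf L_S(b)|\ge2$ and $\operatorname{LD}_S(b)=\operatorname{LD}(S)$.
   Context: A numerical semigroup is a set $S=\langle n_1,\ldots,n_k\rangle=\{z_1n_1+\cdots+z_kn_k : z_i\in\mathbb Z_{\ge0}\}$, where $n_1,\ldots,n_k$ are its minimal generators. For $n\in S$, $\mathsf Z_S(n)=\{z\in\mathbb Z_{\ge0}^k : n=z_1n_1+\cdots+z_kn_k\}$ is the set of factorizations, and $\mathsf L_S(n)=\{z_1+\cdots+z_k : z\in\mathsf Z_S(n)\}$ is the length set. For $n\in S$ with $|\mathsf L_S(n)|\ge2$, the length density is $\operatorname{LD}_S(n)=\frac{|\mathsf L_S(n)|-1}{\max\mathsf L_S(n)-\min\mathsf L_S(n)}$, and $\operatorname{LD}(S)=\inf\{\operatorname{LD}_S(n): n\in S,\ |\mathsf L_S(n)|\ge2\}$. The factorization graph $\nabla_n$ of $n\in S$ has vertex set $\mathsf Z_S(n)$, with $z,z'$ joined by an edge if $z_i>0$ and $z_i'>0$ for some $i$. An element $n\in S$ is a Betti element if $\nabla_n$ is disconnected; $\operatorname{Betti}(S)$ is the set of Betti elements. *)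

theory Defs
  imports Complex_Main
begin

text \<open>
  A numerical semigroup \<open>S = \<langle>n\<^sub>1, \<dots>, n\<^sub>k\<rangle>\<close> is handled through the list
  \<open>ns = [n\<^sub>1, \<dots>, n\<^sub>k]\<close> of its generators, and a factorization is a list \<open>z\<close> of the same
  length. No condition \<open>gcd (n\<^sub>1, \<dots>, n\<^sub>k) = 1\<close> is imposed; adding it would only rescale elements.
\<close>

definition evaluate :: "nat list \<Rightarrow> nat list \<Rightarrow> nat" where
  "evaluate ns z = (\<Sum>i<length ns. z ! i * ns ! i)"

definition semigroup_of :: "nat list \<Rightarrow> nat set" where
  "semigroup_of ns = {evaluate ns z | z. length z = length ns}"

text \<open>
  No generator can be dropped. This already forces the generators to be distinct and positive.
\<close>

definition minimally_generated_by :: "nat set \<Rightarrow> nat list \<Rightarrow> bool" where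
  "minimally_generated_by S ns \<longleftrightarrow>
     S = semigroup_of ns \<and>
     (\<forall>i<length ns. semigroup_of (take i ns @ drop (Suc i) ns) \<noteq> S)"

definition factorizations :: "nat list \<Rightarrow> nat \<Rightarrow> nat list set" where
  "factorizations ns n = {z. length z = length ns \<and> n = evaluate ns z}"

definition length_set :: "nat list \<Rightarrow> nat \<Rightarrow> nat set" where
  "length_set ns n = sum_list ` factorizations ns n"

text \<open>
  The next definition is meaningful only if the length set has at least two elements; it is
  finite whenever all generators are positive.
\<close>

definition length_density_at :: "nat list \<Rightarrow> nat \<Rightarrow> real" where
  "length_density_at ns n =
     (real (card (length_set ns n)) - 1) /
     (real (Max (length_set ns n)) - real (Min (length_set ns n)))"

definition length_density :: "nat list \<Rightarrow> real" where
  "length_density ns =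
     Inf {length_density_at ns n | n. n \<in> semigroup_of ns \<and> card (length_set ns n) \<ge> 2}"

definition factorization_graph :: "nat list \<Rightarrow> nat \<Rightarrow> (nat list \<times> nat list) set" where
  "factorization_graph ns n =
     {(z, z'). z \<in> factorizations ns n \<and> z' \<in> factorizations ns n \<and> z \<noteq> z' \<and>
               (\<exists>i<length ns. z ! i > 0 \<and> z' ! i > 0)}"

definition factorization_graph_connected :: "nat list \<Rightarrow> nat \<Rightarrow> bool" where
  "factorization_graph_connected ns n \<longleftrightarrow>
     (\<forall>z\<in>factorizations ns n. \<forall>z'\<in>factorizations ns n.
        (z, z') \<in> (factorization_graph ns n)\<^sup>*)"

definition Betti :: "nat list \<Rightarrow> nat set" where
  "Betti ns = {n \<in> semigroup_of ns. \<not> factorization_graph_connected ns n}"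

end

theory Submission
  imports Defs
begin

text \<open>
  Let \<open>1 / D\<close> be the least length density of a Betti element. It suffices that from every length
  that is not maximal one can reach a larger one across lengths with average gap at most \<open>D\<close>.
  This property passes from the Betti elements to all elements: two adjacent factorizations
  share a generator, which can be subtracted from both. It may be read upwards or downwards, and a
  Betti element may satisfy only one of the two versions.

  For three generators, a component of a disconnected factorization graph is a single
  factorization \<open>c e\<^sub>k\<close>. If such an element \<open>b\<close> has at least three lengths, the other
  factorizations use only \<open>n\<^sub>i\<close> and \<open>n\<^sub>j\<close>, their lengths form an arithmetic progression, and the
  only other possible Betti element is \<open>e = lcm (n\<^sub>i, n\<^sub>j)\<close>, whose gap is the step of the
  progression. So for \<open>e \<noteq> b\<close> the length set of \<open>b\<close> is a progression of step at most \<open>D\<close>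
  together with \<open>c\<close>, and the side on which \<open>c\<close> lies decides between the upward and the downward
  reading; for \<open>e = b\<close> there are just three lengths.
\<close>

subsection \<open>Sets of integers with bounded average gaps\<close>

text \<open>The threshold \<open>t\<close> may be any integer: when a shared generator is subtracted
  from two factorizations with lengths on either side of \<open>t\<close>, the shifted threshold
  need not be a length.\<close>

definition dense_step :: "real \<Rightarrow> int set \<Rightarrow> int \<Rightarrow> bool" where
  "dense_step D M t \<longleftrightarrow> (\<exists>u\<in>M. t < u \<and> real_of_int (u - t) \<le> D * real (card (M \<inter> {t<..u})))"

definition dense_steps :: "real \<Rightarrow> int set \<Rightarrow> bool" where
  "dense_steps D M \<longleftrightarrow> (\<forall>t. (\<exists>l\<in>M. l \<le> t) \<longrightarrow> (\<exists>l\<in>M. t < l) \<longrightarrow> dense_step D M t)"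

text \<open>For a set of at least two lengths and \<open>D > 0\<close>, this says that the length
  density is at least \<open>1 / D\<close>.\<close>

definition spread_le :: "real \<Rightarrow> int set \<Rightarrow> bool" where
  "spread_le D M \<longleftrightarrow> (\<forall>l\<in>M. \<forall>u\<in>M. real_of_int (u - l) \<le> D * (real (card M) - 1))"

text \<open>Equivalently, consecutive elements of \<open>N\<close> differ by at most
  \<open>p\<close>; the form with thresholds matches \<open>dense_steps\<close>.\<close>

definition linked :: "int \<Rightarrow> int set \<Rightarrow> bool" where
  "linked p N \<longleftrightarrow> (\<forall>t. (\<exists>l\<in>N. l \<le> t) \<longrightarrow> (\<exists>l\<in>N. t < l) \<longrightarrow>
     (\<exists>v\<in>N. \<exists>u\<in>N. v \<le> t \<and> t < u \<and> u \<le> v + p))"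

text \<open>The shifted \<open>u\<close> still works: a larger set can only raise the count, and
  \<open>D \<ge> 0\<close> keeps the inequality.\<close>

lemma dense_step_shift_mono:
  assumes "dense_step D M t" and "(\<lambda>x. x + d) ` M \<subseteq> M'" and "finite M'" and "D \<ge> 0"
  shows "dense_step D M' (t + d)"
proof -
  obtain u where u: "u \<in> M" "t < u" "real_of_int (u - t) \<le> D * real (card (M \<inter> {t<..u}))"
    using assms(1) unfolding dense_step_def by blast
  have "card (M \<inter> {t<..u}) = card ((\<lambda>x. x + d) ` (M \<inter> {t<..u}))"
    by (simp add: card_image)
  also have "\<dots> \<le> card (M' \<inter> {t + d<..u + d})"
    using assms(2,3) by (intro card_mono) auto
  finally have "D * real (card (M \<inter> {t<..u})) \<le> D * real (card (M' \<inter> {t + d<..u + d}))"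
    using assms(4) by (intro mult_left_mono) auto
  then show ?thesis
    unfolding dense_step_def using u assms(2) by (intro bexI[of _ "u + d"]) auto
qed

text \<open>Steps are chained until \<open>Max M\<close> is reached. They count elements in disjoint
  half-open intervals, so their bounds add up; the induction is on the number of elements above
  \<open>t\<close>.\<close>

lemma dense_steps_imp_spread_le:
  assumes fin: "finite M" and dense: "dense_steps D M" and D: "D \<ge> 0"
  shows "spread_le D M"
proof -
  have key: "real_of_int (Max M - t) \<le> D * real (card (M \<inter> {t<..}))" if "t \<in> M" for t
    using that
  proof (induction "card (M \<inter> {t<..})" arbitrary: t rule: less_induct)
    case less
    show ?case
    proof (cases "t = Max M")
      case True
      then show ?thesis using D by simp
    next
      case False
      then have "t < Max M" and "Max M \<in> M"
        using less.prems Max_ge[OF fin less.prems] Max_in[OF fin] by (auto simp del: Max_ge)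
      then have "dense_step D M t"
        using dense less.prems unfolding dense_steps_def by blast
      then obtain u where u: "u \<in> M" "t < u"
        and le: "real_of_int (u - t) \<le> D * real (card (M \<inter> {t<..u}))"
        unfolding dense_step_def by blast
      have split: "M \<inter> {t<..} = (M \<inter> {t<..u}) \<union> (M \<inter> {u<..})"
        using u by auto
      have card: "card (M \<inter> {t<..}) = card (M \<inter> {t<..u}) + card (M \<inter> {u<..})"
        unfolding split by (rule card_Un_disjoint) (use fin in auto)
      have "card (M \<inter> {t<..u}) > 0"
        using u fin by (auto simp: card_gt_0_iff)
      then have "real_of_int (Max M - u) \<le> D * real (card (M \<inter> {u<..}))"
        using card u by (intro less.hyps) auto
      then show ?thesis
        using le card by (simp add: algebra_simps)
    qed
  qed
  show ?thesis
    unfolding spread_le_def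
  proof (intro ballI)
    fix l u
    assume "l \<in> M" "u \<in> M"
    have "card (M \<inter> {l<..}) \<le> card (M - {l})"
      using fin by (intro card_mono) auto
    then have "real (card (M \<inter> {l<..})) \<le> real (card M) - 1"
      using \<open>l \<in> M\<close> fin card_gt_0_iff[of M] by (auto simp: card_Diff_singleton)
    then have "D * real (card (M \<inter> {l<..})) \<le> D * (real (card M) - 1)"
      using D by (intro mult_left_mono) auto
    moreover have "u \<le> Max M"
      using \<open>u \<in> M\<close> fin by auto
    ultimately show "real_of_int (u - l) \<le> D * (real (card M) - 1)"
      using key[OF \<open>l \<in> M\<close>] by linarith
  qed
qed

lemma spread_le_uminus:
  assumes "spread_le D M"
  shows "spread_le D (uminus ` M)"
  using assms unfolding spread_le_def by (simp add: card_image)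

lemma dense_step_le:
  assumes "finite M" and "u \<in> M" and "t < u" and "real_of_int (u - t) \<le> D"
  shows "dense_step D M t"
proof -
  have "card (M \<inter> {t<..u}) > 0"
    using assms by (auto simp: card_gt_0_iff)
  moreover have "D \<ge> 0"
    using assms(3,4) by linarith
  ultimately have "D * 1 \<le> D * real (card (M \<inter> {t<..u}))"
    by (intro mult_left_mono) auto
  then have "real_of_int (u - t) \<le> D * real (card (M \<inter> {t<..u}))"
    using assms(4) by linarith
  then show ?thesis
    unfolding dense_step_def using assms(2,3) by blast
qed

lemma dense_steps_card_le_2:
  assumes fin: "finite M" and card: "card M \<le> 2" and spread: "spread_le D M"
  shows "dense_steps D M"
  unfolding dense_steps_def
proof (intro allI impI)
  fix t
  assume "\<exists>l\<in>M. l \<le> t" "\<exists>l\<in>M. t < l"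
  then obtain l u where lu: "l \<in> M" "u \<in> M" "l \<le> t" "t < u"
    by blast
  have "card {l, u} \<le> card M"
    using lu fin by (intro card_mono) auto
  then have "card M = 2"
    using lu card by auto
  then have "real_of_int (u - l) \<le> D"
    using spread lu unfolding spread_le_def by fastforce
  then show "dense_step D M t"
    using lu fin by (intro dense_step_le) auto
qed

lemma linked_uminus:
  assumes "linked p N"
  shows "linked p (uminus ` N)"
  unfolding linked_def
proof (intro allI impI)
  fix t
  assume "\<exists>l\<in>uminus ` N. l \<le> t" "\<exists>l\<in>uminus ` N. t < l"
  then obtain l u where "l \<in> N" "u \<in> N" "- l \<le> t" "t < - u"
    by blast
  \<comment> \<open>Negation swaps the strict and the weak side of a threshold, so over the integers
    \<open>t\<close> becomes \<open>- t - 1\<close>.\<close>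
  then have "u \<le> - t - 1" "- t - 1 < l"
    by linarith+
  then have "\<exists>v\<in>N. \<exists>w\<in>N. v \<le> - t - 1 \<and> - t - 1 < w \<and> w \<le> v + p"
    using assms \<open>l \<in> N\<close> \<open>u \<in> N\<close> unfolding linked_def by blast
  then obtain v w where "v \<in> N" "w \<in> N" "v \<le> - t - 1" "- t - 1 < w" "w \<le> v + p"
    by blast
  then show "\<exists>v\<in>uminus ` N. \<exists>u\<in>uminus ` N. v \<le> t \<and> t < u \<and> u \<le> v + p"
    by (intro bexI[of _ "- w"] bexI[of _ "- v"]) auto
qed

text \<open>If \<open>N\<close> has an element at or below \<open>t\<close>, the gap of
  \<open>N\<close> across \<open>t\<close> is at most \<open>p \<le> D\<close>. Otherwise a single
  step to \<open>Max N\<close> is bounded by the spread of the whole set. As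
  \<open>c \<le> x\<close>, the element above \<open>t\<close> can always be taken in
  \<open>N\<close>; \<open>c\<close> itself may lie among the elements of \<open>N\<close>.\<close>

lemma dense_steps_insert_below:
  assumes fin: "finite N" and linked: "linked p N" and p: "real_of_int p \<le> D"
    and spread: "spread_le D (insert c N)" and c: "x \<in> N" "c \<le> x"
  shows "dense_steps D (insert c N)"
  unfolding dense_steps_def
proof (intro allI impI)
  fix t
  assume lu: "\<exists>l\<in>insert c N. l \<le> t" "\<exists>l\<in>insert c N. t < l"
  then have above: "\<exists>l\<in>N. t < l"
    using c by (metis insert_iff less_le_trans)
  show "dense_step D (insert c N) t"
  proof (cases "\<exists>l\<in>N. l \<le> t")
    case True
    then obtain v u where "u \<in> N" "v \<le> t" "t < u" "u \<le> v + p"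
      using linked above unfolding linked_def by blast
    then show ?thesis
      using fin p by (intro dense_step_le[of _ u]) auto
  next
    case False
    then have "c \<le> t" and gt: "\<And>l. l \<in> N \<Longrightarrow> t < l"
      using lu(1) by force+
    have "c \<notin> N" and ne: "N \<noteq> {}"
      using False \<open>c \<le> t\<close> c by auto
    \<comment> \<open>Since \<open>c \<le> t\<close>, the element \<open>c\<close> is not counted;
      the count \<open>card N\<close> is exactly the factor \<open>card (insert c N) - 1\<close> of
      \<open>spread_le\<close>.\<close>
    have "insert c N \<inter> {t<..Max N} = N"
      using gt fin \<open>c \<le> t\<close> by auto
    moreover have "real_of_int (Max N - c) \<le> D * real (card N)"
      using spread Max_in[OF fin ne] \<open>c \<notin> N\<close> fin unfolding spread_le_def by auto
    ultimately show ?thesis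
      unfolding dense_step_def using Max_in[OF fin ne] gt \<open>c \<le> t\<close>
      by (intro bexI[of _ "Max N"]) auto
  qed
qed

text \<open>Comparing \<open>c\<close> with any one element of \<open>N\<close> decides the
  direction: if \<open>c\<close> is larger, negation moves it below.\<close>

lemma dense_steps_insert:
  assumes fin: "finite N" and linked: "linked p N" and p: "real_of_int p \<le> D"
    and spread: "spread_le D (insert c N)" and ne: "N \<noteq> {}"
  shows "dense_steps D (insert c N) \<or> dense_steps D (uminus ` insert c N)"
proof -
  obtain x where x: "x \<in> N"
    using ne by blast
  show ?thesis
  proof (cases "c \<le> x")
    case True
    then show ?thesis
      using dense_steps_insert_below assms x by blast
  next
    case False
    have "dense_steps D (insert (- c) (uminus ` N))"
      using False x fin p linked_uminus[OF linked] spread_le_uminus[OF spread]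
      by (intro dense_steps_insert_below[where x = "- x"]) auto
    then show ?thesis by simp
  qed
qed

text \<open>The two gaps sum to at most \<open>2 * D\<close>, so one of them is at most
  \<open>D\<close>. Its endpoints serve as the linked set, and the remaining element is the inserted
  one.\<close>

lemma dense_steps_three:
  assumes spread: "spread_le D {a, b, c :: int}" and neq: "a \<noteq> b" "a \<noteq> c" "b \<noteq> c"
  shows "dense_steps D {a, b, c} \<or> dense_steps D (uminus ` {a, b, c})"
proof -
  have sorted: "dense_steps D {x, y, z} \<or> dense_steps D (uminus ` {x, y, z})"
    if "x < y" "y < z" and sp: "spread_le D {x, y, z}" for x y z :: int
  proof -
    have le: "real_of_int (z - x) \<le> 2 * D"
      using sp that unfolding spread_le_def by simp
    have linked2: "linked (v - u) {u, v}" if "u < v" for u v :: int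
      using that unfolding linked_def by auto
    show ?thesis
    proof (cases "real_of_int (z - y) \<le> D")
      case True
      then show ?thesis
        using dense_steps_insert[OF _ linked2[OF \<open>y < z\<close>] _ sp] by simp
    next
      case False
      then have "real_of_int (y - x) \<le> D"
        using le by simp
      moreover have "spread_le D (insert z {x, y})"
        using sp by (simp add: insert_commute)
      ultimately have "dense_steps D (insert z {x, y}) \<or> dense_steps D (uminus ` insert z {x, y})"
        using dense_steps_insert[OF _ linked2[OF \<open>x < y\<close>]] by simp
      then show ?thesis
        by (simp add: insert_commute)
    qed
  qed
  consider "a < b" "b < c" | "a < c" "c < b" | "b < a" "a < c" | "b < c" "c < a"
    | "c < a" "a < b" | "c < b" "b < a"
    using neq by linarith
  then show ?thesis
    using sorted[of a b c] sorted[of a c b] sorted[of b a c] sorted[of b c a] sorted[of c a b]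
      sorted[of c b a] spread
    by cases (simp_all add: insert_commute)
qed

subsection \<open>Passing from Betti elements to all elements\<close>

text \<open>The sign \<open>s\<close> is 1 for the upward reading and -1 for the downward one, so
  one induction serves both.\<close>

definition signed_lengths :: "nat list \<Rightarrow> int \<Rightarrow> nat \<Rightarrow> int set" where
  "signed_lengths ns s n = (\<lambda>l. s * int l) ` length_set ns n"

lemma evaluate_increment:
  assumes "i < length ns" and "length z = length ns"
  shows "evaluate ns (z[i := z ! i + d]) = evaluate ns z + d * ns ! i"
proof -
  have "evaluate ns (z[i := z ! i + d])
      = (\<Sum>h<length ns. z ! h * ns ! h + (if h = i then d * ns ! i else 0))"
    unfolding evaluate_def using assms
    by (intro sum.cong) (auto simp: nth_list_update algebra_simps)
  also have "\<dots> = evaluate ns z + d * ns ! i"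
    unfolding evaluate_def using assms by (simp add: sum.distrib)
  finally show ?thesis .
qed

lemma sum_list_increment:
  fixes z :: "nat list"
  assumes "i < length z"
  shows "sum_list (z[i := z ! i + d]) = sum_list z + d"
  using assms elem_le_sum_list[OF assms] by (simp add: sum_list_update)

lemma factorizations_nth_le:
  assumes "z \<in> factorizations ns n" and "i < length ns" and "0 < ns ! i"
  shows "z ! i * ns ! i \<le> n" and "z ! i \<le> n"
proof -
  have "(\<lambda>h. z ! h * ns ! h) i \<le> (\<Sum>h<length ns. z ! h * ns ! h)"
    using assms(2) by (intro member_le_sum) auto
  then show *: "z ! i * ns ! i \<le> n"
    using assms(1) by (simp add: factorizations_def evaluate_def)
  have "z ! i * 1 \<le> z ! i * ns ! i"
    using assms(3) by (intro mult_le_mono2) auto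
  then show "z ! i \<le> n"
    using * by linarith
qed

lemma finite_length_set:
  assumes pos: "\<forall>i<length ns. 0 < ns ! i"
  shows "finite (length_set ns n)"
proof -
  have "factorizations ns n \<subseteq> {z. set z \<subseteq> {..n} \<and> length z = length ns}"
    using factorizations_nth_le(2) pos
    by (fastforce simp: in_set_conv_nth factorizations_def)
  then have "finite (factorizations ns n)"
    using finite_lists_length_eq[of "{..n}" "length ns"] finite_subset by blast
  then show ?thesis
    unfolding length_set_def by simp
qed

lemma finite_signed_lengths:
  assumes "\<forall>i<length ns. 0 < ns ! i"
  shows "finite (signed_lengths ns s n)"
  unfolding signed_lengths_def using finite_length_set[OF assms] by simp

lemma factorization_decrement:
  assumes "z \<in> factorizations ns n" and "i < length ns" and "0 < z ! i"
  obtains y where "y \<in> factorizations ns (n - ns ! i)" "ns ! i \<le> n"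
    "sum_list z = sum_list y + 1"
proof
  define y where "y = z[i := z ! i - 1]"
  have len: "length z = length ns" "length y = length ns"
    using assms(1) unfolding y_def by (simp_all add: factorizations_def)
  have z: "y[i := y ! i + 1] = z"
    using assms len unfolding y_def by simp
  have "n = evaluate ns y + ns ! i"
    using assms(1) evaluate_increment[OF assms(2) len(2), of 1] unfolding z
    by (simp add: factorizations_def)
  then show "y \<in> factorizations ns (n - ns ! i)" "ns ! i \<le> n"
    using len by (auto simp: factorizations_def)
  show "sum_list z = sum_list y + 1"
    using sum_list_increment[of i y 1] assms(2) len(2) unfolding z by simp
qed

text \<open>One more copy of generator \<open>i\<close> raises the length by 1 and hence the signed
  length by \<open>s\<close>.\<close>

lemma signed_lengths_shift:
  assumes "i < length ns" and "ns ! i \<le> n"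
  shows "(\<lambda>x. x + s) ` signed_lengths ns s (n - ns ! i) \<subseteq> signed_lengths ns s n"
proof
  fix x
  assume "x \<in> (\<lambda>x. x + s) ` signed_lengths ns s (n - ns ! i)"
  then obtain z where z: "z \<in> factorizations ns (n - ns ! i)"
    and x: "x = s * int (sum_list z) + s"
    unfolding signed_lengths_def length_set_def by auto
  have "z[i := z ! i + 1] \<in> factorizations ns n"
    using z assms evaluate_increment[of i ns z 1] by (auto simp: factorizations_def)
  moreover have "sum_list (z[i := z ! i + 1]) = sum_list z + 1"
    using z assms by (intro sum_list_increment) (auto simp: factorizations_def)
  ultimately show "x \<in> signed_lengths ns s n"
    unfolding signed_lengths_def length_set_def x
    by (intro image_eqI[of _ _ "sum_list (z[i := z ! i + 1])"] imageI)
      (auto simp: algebra_simps)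
qed

lemma rtrancl_crossing:
  assumes "(x, y) \<in> R\<^sup>*" and "P x" and "\<not> P y"
  shows "\<exists>a b. (a, b) \<in> R \<and> P a \<and> \<not> P b"
  using assms by (induction rule: rtrancl_induct) blast+

text \<open>If \<open>n\<close> is not a Betti element, a path between factorizations on the two
  sides of \<open>t\<close> has an edge that crosses \<open>t\<close>. Removing a generator shared
  by its endpoints leaves two factorizations of a smaller element on the two sides of
  \<open>t - s\<close>; the dense step found there is shifted back by \<open>s\<close>.\<close>

theorem dense_steps_of_Betti:
  assumes pos: "\<forall>i<length ns. 0 < ns ! i" and D: "D \<ge> 0"
    and Betti: "\<And>b. b \<in> Betti ns \<Longrightarrow> dense_steps D (signed_lengths ns s b)"
  shows "dense_steps D (signed_lengths ns s n)"
proof (induction n rule: less_induct)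
  case (less n)
  show ?case
  proof (cases "n \<in> Betti ns")
    case True
    then show ?thesis by (rule Betti)
  next
    case False
    show ?thesis
      unfolding dense_steps_def
    proof (intro allI impI)
      fix t
      assume "\<exists>l\<in>signed_lengths ns s n. l \<le> t" "\<exists>l\<in>signed_lengths ns s n. t < l"
      then obtain z y where zy: "z \<in> factorizations ns n" "y \<in> factorizations ns n"
        "s * int (sum_list z) \<le> t" "\<not> s * int (sum_list y) \<le> t"
        unfolding signed_lengths_def length_set_def by (auto simp: not_le)
      then have "n \<in> semigroup_of ns"
        by (auto simp: factorizations_def semigroup_of_def)
      then have "(z, y) \<in> (factorization_graph ns n)\<^sup>*"
        using False zy unfolding Betti_def factorization_graph_connected_def by blast
      then obtain a b where ab: "(a, b) \<in> factorization_graph ns n"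
        "s * int (sum_list a) \<le> t" "\<not> s * int (sum_list b) \<le> t"
        using rtrancl_crossing[of z y _ "\<lambda>z. s * int (sum_list z) \<le> t"] zy(3,4) by blast
      then obtain i where i: "i < length ns" "0 < a ! i" "0 < b ! i"
        and mem: "a \<in> factorizations ns n" "b \<in> factorizations ns n"
        unfolding factorization_graph_def by blast
      obtain a' where a': "a' \<in> factorizations ns (n - ns ! i)" "ns ! i \<le> n"
        "sum_list a = sum_list a' + 1"
        using factorization_decrement mem(1) i by metis
      obtain b' where b': "b' \<in> factorizations ns (n - ns ! i)"
        "sum_list b = sum_list b' + 1"
        using factorization_decrement mem(2) i by metis
      have "dense_steps D (signed_lengths ns s (n - ns ! i))"
        using pos i(1) a'(2) by (intro less.IH) auto
      moreover have "s * int (sum_list a') \<le> t - s" "t - s < s * int (sum_list b')"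
        using ab(2,3) a'(3) b'(2) by (auto simp: algebra_simps)
      ultimately have "dense_step D (signed_lengths ns s (n - ns ! i)) (t - s)"
        using a'(1) b'(1) unfolding dense_steps_def signed_lengths_def length_set_def by blast
      then have "dense_step D (signed_lengths ns s n) (t - s + s)"
        using signed_lengths_shift[OF i(1) a'(2)] finite_signed_lengths[OF pos] D
        by (rule dense_step_shift_mono)
      then show "dense_step D (signed_lengths ns s n) t"
        by simp
    qed
  qed
qed

subsection \<open>Isolated factorizations\<close>

text \<open>Here \<open>w\<close> is a multiple of the \<open>k\<close>-th unit vector and forms a
  component on its own; the last conjunct makes the graph disconnected.\<close>

definition isolated :: "nat list \<Rightarrow> nat \<Rightarrow> nat \<Rightarrow> bool" where
  "isolated ns k b \<longleftrightarrow> (\<exists>w\<in>factorizations ns b.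
     (\<forall>h<length ns. h \<noteq> k \<longrightarrow> w ! h = 0) \<and>
     (\<forall>v\<in>factorizations ns b. v \<noteq> w \<longrightarrow> v ! k = 0) \<and>
     (\<exists>v\<in>factorizations ns b. v \<noteq> w))"

text \<open>The vertex \<open>w\<close> has no neighbour: it can be positive only at
  \<open>k\<close>, where every other factorization vanishes.\<close>

lemma isolated_imp_Betti:
  assumes "isolated ns k b"
  shows "b \<in> Betti ns"
proof -
  obtain w v where w: "w \<in> factorizations ns b" "\<forall>h<length ns. h \<noteq> k \<longrightarrow> w ! h = 0"
    "\<forall>v\<in>factorizations ns b. v \<noteq> w \<longrightarrow> v ! k = 0"
    and v: "v \<in> factorizations ns b" "v \<noteq> w"
    using assms unfolding isolated_def by blast
  have "(w, x) \<notin> factorization_graph ns b" for x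
    using w unfolding factorization_graph_def by force
  then have "(w, v) \<notin> (factorization_graph ns b)\<^sup>*"
    using v(2) by (metis converse_rtranclE)
  then have "\<not> factorization_graph_connected ns b"
    unfolding factorization_graph_connected_def using w(1) v(1) by blast
  moreover have "b \<in> semigroup_of ns"
    using w(1) by (auto simp: factorizations_def semigroup_of_def)
  ultimately show ?thesis
    unfolding Betti_def by blast
qed

lemma factorizations_eq_zero:
  assumes "\<forall>i<length ns. 0 < ns ! i" and "v \<in> factorizations ns 0" and "w \<in> factorizations ns 0"
  shows "v = w"
proof (rule nth_equalityI)
  show "length v = length w"
    using assms by (simp add: factorizations_def)
  fix i
  assume "i < length v"
  then show "v ! i = w ! i"
    using assms factorizations_nth_le(2)[of _ ns 0 i] by (auto simp: factorizations_def)
qed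

text \<open>Suppose \<open>b < b'\<close> are both isolated at \<open>k\<close>. Adding copies of
  \<open>ns ! k\<close> to a second factorization of \<open>b\<close> yields a factorization of
  \<open>b'\<close> that is positive at \<open>k\<close>, hence the isolated one. Comparing
  coordinates at \<open>k\<close> gives \<open>b = 0\<close>, which has only one
  factorization.\<close>

lemma isolated_unique:
  assumes pos: "\<forall>i<length ns. 0 < ns ! i" and k: "k < length ns"
    and b: "isolated ns k b" and b': "isolated ns k b'"
  shows "b = b'"
proof -
  have le: "b' \<le> b" if b: "isolated ns k b" and b': "isolated ns k b'" for b b'
  proof (rule ccontr)
    assume "\<not> b' \<le> b"
    obtain w v where w: "w \<in> factorizations ns b" "\<forall>h<length ns. h \<noteq> k \<longrightarrow> w ! h = 0"
      "\<forall>v\<in>factorizations ns b. v \<noteq> w \<longrightarrow> v ! k = 0"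
      and v: "v \<in> factorizations ns b" "v \<noteq> w"
      using b unfolding isolated_def by blast
    obtain w' where w': "w' \<in> factorizations ns b'" "\<forall>h<length ns. h \<noteq> k \<longrightarrow> w' ! h = 0"
      "\<forall>v\<in>factorizations ns b'. v \<noteq> w' \<longrightarrow> v ! k = 0"
      using b' unfolding isolated_def by blast
    have eval: "x = u ! k * ns ! k"
      if "u \<in> factorizations ns x" "\<forall>h<length ns. h \<noteq> k \<longrightarrow> u ! h = 0" for x u
    proof -
      have "evaluate ns u = (\<Sum>h\<in>{k}. u ! h * ns ! h)"
        unfolding evaluate_def using that(2) k by (intro sum.mono_neutral_right) auto
      then show ?thesis
        using that(1) by (simp add: factorizations_def)
    qed
    have eq: "b = w ! k * ns ! k" "b' = w' ! k * ns ! k"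
      using eval w(1,2) w'(1,2) by auto
    then have lt: "w ! k < w' ! k"
      using \<open>\<not> b' \<le> b\<close> by auto
    define d where "d = w' ! k - w ! k"
    have len: "length v = length ns"
      using v(1) by (simp add: factorizations_def)
    have vk: "v ! k = 0"
      using w(3) v by blast
    have "b' = b + d * ns ! k"
      unfolding eq d_def using lt by (simp flip: add_mult_distrib)
    then have "v[k := v ! k + d] \<in> factorizations ns b'"
      using evaluate_increment[OF k len, of d] v(1) by (simp add: factorizations_def)
    moreover have "v[k := v ! k + d] ! k \<noteq> 0"
      using k len lt by (simp add: d_def)
    ultimately have "v[k := v ! k + d] = w'"
      using bspec[OF w'(3)] by metis
    then have "w' ! k = v[k := v ! k + d] ! k"
      by simp
    then have "d = w' ! k"
      using k len vk by simp
    then have "w ! k = 0"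
      using lt by (simp add: d_def)
    then have "b = 0"
      using eq by simp
    then show False
      using factorizations_eq_zero[OF pos] v w(1) by blast
  qed
  show ?thesis
    using le[OF b b'] le[OF b' b] by simp
qed

lemma disjoint_subsets_of_three:
  assumes "X \<subseteq> {..<3::nat}" "Y \<subseteq> {..<3}" "X \<inter> Y = {}" "X \<noteq> {}" "Y \<noteq> {}"
  shows "(\<exists>k. X = {k}) \<or> (\<exists>k. Y = {k})"
proof -
  have fin: "finite X" "finite Y"
    using assms(1,2) by (auto intro: finite_subset)
  then have "card X + card Y = card (X \<union> Y)"
    using assms by (simp add: card_Un_disjoint)
  also have "\<dots> \<le> card {..<3::nat}"
    using assms by (intro card_mono) auto
  finally have "card X + card Y \<le> 3"
    by simp
  moreover have "card X > 0" "card Y > 0"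
    using fin assms by (auto simp: card_gt_0_iff)
  ultimately have "card X = 1 \<or> card Y = 1"
    by linarith
  then show ?thesis
    by (auto simp: card_1_singleton_iff)
qed

section \<open>Factorizations with two generators\<close>

lemma two_generator_relation:
  fixes a b x y x' y' :: nat
  assumes pos: "0 < a" "0 < b" and eq: "x * a + y * b = x' * a + y' * b" and le: "x \<le> x'"
  obtains \<tau> where "x' = x + \<tau> * (b div gcd a b)" "y = y' + \<tau> * (a div gcd a b)"
proof -
  define g where "g = gcd a b"
  define p q where "p = a div g" and "q = b div g"
  have ab: "a = p * g" "b = q * g" and g: "g > 0"
    unfolding p_def q_def g_def using pos by auto
  have cop: "coprime p q"
    unfolding p_def q_def g_def using pos by (intro div_gcd_coprime) auto
  have q: "q > 0"
    using pos ab by auto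
  obtain d where d: "x' = x + d"
    using le le_iff_add by blast
  \<comment> \<open>Cancelling the gcd leaves the coprime coefficients \<open>p\<close> and
    \<open>q\<close>, so \<open>q\<close> must divide the difference \<open>d\<close> of the first
    coordinates.\<close>
  have "g * (y * q) = g * (d * p + y' * q)"
    using eq unfolding d ab by (simp add: algebra_simps)
  then have yq: "y * q = d * p + y' * q"
    using g by simp
  then have "y' * q \<le> y * q"
    by simp
  then obtain e where e: "y = y' + e"
    using q le_iff_add by auto
  have dp: "d * p = e * q"
    using yq unfolding e by (simp add: algebra_simps)
  then have "q dvd d * p"
    by simp
  then have "q dvd d"
    using cop by (simp add: coprime_dvd_mult_left_iff coprime_commute)
  then obtain \<tau> where \<tau>: "d = q * \<tau>"
    by blast
  then have "e = \<tau> * p"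
    using dp q by (simp add: algebra_simps)
  then show thesis
    using that[of \<tau>] d e \<tau> unfolding p_def q_def g_def by (simp add: algebra_simps)
qed

text \<open>A discrete intermediate value argument: some single step of the sequence crosses
  \<open>t\<close>, upwards or downwards.\<close>

lemma linked_sequence:
  fixes f :: "nat \<Rightarrow> int"
  assumes "\<And>q. q < m \<Longrightarrow> \<bar>f (Suc q) - f q\<bar> \<le> p"
    and "f 0 \<le> t \<and> t < f m \<or> t < f 0 \<and> f m \<le> t"
  shows "\<exists>q\<le>m. \<exists>r\<le>m. f q \<le> t \<and> t < f r \<and> f r \<le> f q + p"
  using assms
proof (induction m)
  case 0
  then show ?case by auto
next
  case (Suc m)
  show ?case
  proof (cases "f 0 \<le> t \<and> t < f m \<or> t < f 0 \<and> f m \<le> t")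
    case True
    have "\<exists>q\<le>m. \<exists>r\<le>m. f q \<le> t \<and> t < f r \<and> f r \<le> f q + p"
      using Suc.prems(1) True by (intro Suc.IH) auto
    then show ?thesis
      by (meson le_SucI)
  next
    case False
    then have "f m \<le> t \<and> t < f (Suc m) \<or> t < f m \<and> f (Suc m) \<le> t"
      using Suc.prems(2) by linarith
    moreover have "\<bar>f (Suc m) - f m\<bar> \<le> p"
      using Suc.prems(1) by simp
    ultimately have "(f m \<le> t \<and> t < f (Suc m) \<and> f (Suc m) \<le> f m + p)
      \<or> (f (Suc m) \<le> t \<and> t < f m \<and> f m \<le> f (Suc m) + p)"
      by linarith
    then show ?thesis
      by (meson le_SucI order_refl)
  qed
qed

text \<open>Any two factorizations are joined by successive trades of \<open>a div gcd a b\<close>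
  copies of \<open>b\<close> for \<open>b div gcd a b\<close> copies of \<open>a\<close>; each trade
  changes the length by the difference of these two numbers.\<close>

lemma linked_two_generator_lengths:
  fixes a b n :: nat
  assumes pos: "0 < a" "0 < b"
  shows "linked \<bar>int (b div gcd a b) - int (a div gcd a b)\<bar>
    {int (x + y) | x y. x * a + y * b = n}"
    (is "linked ?p ?N")
proof -
  define \<alpha> \<beta> where "\<alpha> = b div gcd a b" and "\<beta> = a div gcd a b"
  have \<alpha>\<beta>: "\<alpha> * a = \<beta> * b"
    unfolding \<alpha>_def \<beta>_def by (metis div_mult_swap dvd_div_mult gcd_dvd1 gcd_dvd2 mult.commute)
  \<comment> \<open>Only the order of \<open>x\<close> and \<open>x'\<close> is normalized, so the
    lengths may cross \<open>t\<close> in either direction.\<close>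
  have wlog: "\<exists>v\<in>?N. \<exists>u\<in>?N. v \<le> t \<and> t < u \<and> u \<le> v + \<bar>int \<alpha> - int \<beta>\<bar>"
    if n: "x * a + y * b = n" "x' * a + y' * b = n" and le: "x \<le> x'"
      and t: "int (x + y) \<le> t \<and> t < int (x' + y') \<or> t < int (x + y) \<and> int (x' + y') \<le> t"
    for x y x' y' t
  proof -
    obtain \<tau> where \<tau>: "x' = x + \<tau> * \<alpha>" "y = y' + \<tau> * \<beta>"
      using two_generator_relation[OF pos, of x y x' y'] n le unfolding \<alpha>_def \<beta>_def by metis
    \<comment> \<open>The length after \<open>q\<close> trades; the subtraction
      \<open>\<tau> - q\<close> is not truncated, as \<open>q \<le> \<tau>\<close>
      throughout.\<close>
    define f where "f q = int ((x + q * \<alpha>) + (y' + (\<tau> - q) * \<beta>))" for q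
    have mem: "f q \<in> ?N" if "q \<le> \<tau>" for q
    proof -
      obtain d where d: "\<tau> = q + d"
        using le_Suc_ex[OF \<open>q \<le> \<tau>\<close>] by blast
      have "(x + q * \<alpha>) * a + (y' + d * \<beta>) * b = x * a + q * (\<alpha> * a) + (y' + d * \<beta>) * b"
        by (simp add: algebra_simps)
      also have "\<dots> = x * a + y * b"
        unfolding \<alpha>\<beta> \<tau>(2) d by (simp add: algebra_simps)
      also have "\<dots> = n"
        by (rule n(1))
      finally have "(x + q * \<alpha>) * a + (y' + (\<tau> - q) * \<beta>) * b = n"
        unfolding d by simp
      then show ?thesis
        unfolding f_def by blast
    qed
    have "\<bar>f (Suc q) - f q\<bar> \<le> \<bar>int \<alpha> - int \<beta>\<bar>" if "q < \<tau>" for q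
    proof -
      have "\<tau> - q = Suc (\<tau> - Suc q)"
        using that by simp
      then show ?thesis
        unfolding f_def by simp
    qed
    moreover have "f 0 = int (x + y)" "f \<tau> = int (x' + y')"
      unfolding f_def \<tau> by simp_all
    ultimately have "\<exists>q\<le>\<tau>. \<exists>r\<le>\<tau>. f q \<le> t \<and> t < f r \<and> f r \<le> f q + \<bar>int \<alpha> - int \<beta>\<bar>"
      using t by (intro linked_sequence) auto
    then obtain q r where "q \<le> \<tau>" "r \<le> \<tau>"
      and qr: "f q \<le> t \<and> t < f r \<and> f r \<le> f q + \<bar>int \<alpha> - int \<beta>\<bar>"
      by (elim exE conjE) simp
    show ?thesis
      by (intro bexI[of _ "f q"] bexI[of _ "f r"] qr mem \<open>q \<le> \<tau>\<close> \<open>r \<le> \<tau>\<close>)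
  qed
  show ?thesis
    unfolding linked_def
  proof (intro allI impI)
    fix t
    assume "\<exists>l\<in>?N. l \<le> t" "\<exists>l\<in>?N. t < l"
    then obtain x y x' y' where "x * a + y * b = n" "x' * a + y' * b = n"
      "int (x + y) \<le> t" "t < int (x' + y')"
      by blast
    then have "\<exists>v\<in>?N. \<exists>u\<in>?N. v \<le> t \<and> t < u \<and> u \<le> v + \<bar>int \<alpha> - int \<beta>\<bar>"
      using wlog[of x y x' y' t] wlog[of x' y' x y t] by (cases "x \<le> x'") simp_all
    then show "\<exists>v\<in>?N. \<exists>u\<in>?N. v \<le> t \<and> t < u \<and> u \<le> v + ?p"
      unfolding \<alpha>_def \<beta>_def .
  qed
qed

text \<open>The supports of a component and of its complement are disjoint nonempty sets of indices.
  Among three indices one of these supports is a singleton \<open>{k}\<close>, and on that side only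
  one multiple of the \<open>k\<close>-th unit vector can evaluate to \<open>b\<close>.\<close>

lemma Betti_imp_isolated:
  assumes len: "length ns = 3" and pos: "\<forall>i<length ns. 0 < ns ! i" and b: "b \<in> Betti ns"
  shows "\<exists>k<3. isolated ns k b"
proof -
  let ?Z = "factorizations ns b"
  define supp where "supp X = {h. h < 3 \<and> (\<exists>v\<in>X. 0 < v ! h)}" for X :: "nat list set"
  obtain z y where zy: "z \<in> ?Z" "y \<in> ?Z" "(z, y) \<notin> (factorization_graph ns b)\<^sup>*"
    using b unfolding Betti_def factorization_graph_connected_def by blast
  define C where "C = {v \<in> ?Z. (z, v) \<in> (factorization_graph ns b)\<^sup>*}"
  have C: "C \<subseteq> ?Z" "z \<in> C" "y \<in> ?Z - C"
    using zy unfolding C_def by auto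
  \<comment> \<open>This keeps the zero vector out of the factorizations, so both supports are
    nonempty.\<close>
  have "b \<noteq> 0"
    using zy factorizations_eq_zero[OF pos, of z y] by (metis rtrancl.rtrancl_refl)
  have nonzero: "\<exists>h<3. 0 < v ! h" if "v \<in> ?Z" for v
  proof (rule ccontr)
    assume "\<not> (\<exists>h<3. 0 < v ! h)"
    then have "evaluate ns v = 0"
      unfolding evaluate_def len by simp
    then show False
      using that \<open>b \<noteq> 0\<close> by (simp add: factorizations_def)
  qed
  have "supp C \<inter> supp (?Z - C) = {}"
  proof (rule ccontr)
    assume "supp C \<inter> supp (?Z - C) \<noteq> {}"
    then obtain h v u where h: "h < 3" "v \<in> C" "0 < v ! h" "u \<in> ?Z" "u \<notin> C" "0 < u ! h"
      unfolding supp_def by blast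
    then have "(v, u) \<in> factorization_graph ns b"
      using C(1) len unfolding factorization_graph_def by auto
    then have "u \<in> C"
      using h unfolding C_def by (auto intro: rtrancl_into_rtrancl)
    then show False
      using h by simp
  qed
  moreover have "supp C \<noteq> {}" "supp (?Z - C) \<noteq> {}"
    using nonzero C zy unfolding supp_def by blast+
  moreover have "supp X \<subseteq> {..<3}" for X
    unfolding supp_def by auto
  ultimately have "(\<exists>k. supp C = {k}) \<or> (\<exists>k. supp (?Z - C) = {k})"
    by (intro disjoint_subsets_of_three) auto
  \<comment> \<open>\<open>X\<close> is whichever of the component and its complement has the
    singleton support.\<close>
  then have "\<exists>X. X \<subseteq> ?Z \<and> (\<exists>k. supp X = {k}) \<and> X \<noteq> {} \<and> ?Z - X \<noteq> {} \<and>
    supp X \<inter> supp (?Z - X) = {}"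
  proof (elim disjE)
    assume "\<exists>k. supp C = {k}"
    then show ?thesis
      using C \<open>supp C \<inter> supp (?Z - C) = {}\<close> by (intro exI[of _ C]) auto
  next
    assume "\<exists>k. supp (?Z - C) = {k}"
    moreover have "?Z - (?Z - C) = C"
      using C(1) by blast
    ultimately show ?thesis
      using C \<open>supp C \<inter> supp (?Z - C) = {}\<close> by (intro exI[of _ "?Z - C"]) auto
  qed
  then obtain X k where X: "X \<subseteq> ?Z" "supp X = {k}" "X \<noteq> {}" "?Z - X \<noteq> {}"
    and disj: "supp X \<inter> supp (?Z - X) = {}"
    by blast
  have k: "k < 3"
    using X(2) unfolding supp_def by blast
  have zero: "v ! h = 0" if "v \<in> X" "h < 3" "h \<noteq> k" for v h
  proof -
    have "h \<notin> supp X"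
      using X(2) that(3) by simp
    then show ?thesis
      using that(1,2) unfolding supp_def by simp
  qed
  have eval: "b = v ! k * ns ! k" if "v \<in> X" for v
  proof -
    have "\<forall>h\<in>{..<3} - {k}. v ! h * ns ! h = 0"
      using zero[OF that] by simp
    then have "evaluate ns v = (\<Sum>h\<in>{k}. v ! h * ns ! h)"
      unfolding evaluate_def len using k by (intro sum.mono_neutral_right) simp_all
    then show ?thesis
      using that X(1) by (auto simp: factorizations_def)
  qed
  obtain w where w: "w \<in> X"
    using X(3) by blast
  have uniq: "v = w" if "v \<in> X" for v
  proof (rule nth_equalityI)
    show "length v = length w"
      using subsetD[OF X(1) that] subsetD[OF X(1) w] by (simp add: factorizations_def)
    fix h
    assume "h < length v"
    then have "h < 3"
      using subsetD[OF X(1) that] len by (simp add: factorizations_def)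
    moreover have "v ! k = w ! k"
      using eval[OF that] eval[OF w] pos k len by auto
    ultimately show "v ! h = w ! h"
      using zero[OF that] zero[OF w] by (cases "h = k") auto
  qed
  have "v ! k = 0" if "v \<in> ?Z" "v \<noteq> w" for v
  proof -
    have "v \<in> ?Z - X"
      using that uniq by blast
    moreover have "k \<notin> supp (?Z - X)"
      using disj X(2) by simp
    ultimately show ?thesis
      using k unfolding supp_def by simp
  qed
  then have "isolated ns k b"
    unfolding isolated_def using w X zero len by (intro bexI[of _ w]) auto
  then show ?thesis
    using k by blast
qed

subsection \<open>Three generators\<close>

locale three_generators =
  fixes ns :: "nat list"
  assumes len: "length ns = 3"
    and pos: "\<forall>i<length ns. 0 < ns ! i"
    and distinct: "distinct ns"

text \<open>The indices are named by role, with \<open>k\<close> for the isolated coordinate, which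
  avoids permuting the list \<open>ns\<close>.\<close>

locale three_generators_indexed = three_generators +
  fixes i j k :: nat
  assumes index: "i < 3" "j < 3" "k < 3" "i \<noteq> j" "i \<noteq> k" "j \<noteq> k"
begin

definition vec :: "nat \<Rightarrow> nat \<Rightarrow> nat \<Rightarrow> nat list" where
  "vec x y z = (replicate 3 0)[i := x, j := y, k := z]"

lemma lessThan_3: "{..<3} = {i, j, k}"
  using index by (intro card_subset_eq[symmetric]) auto

lemma vec_simps [simp]:
  "length (vec x y z) = 3" "vec x y z ! i = x" "vec x y z ! j = y" "vec x y z ! k = z"
  using index unfolding vec_def by simp_all

lemma vec_eq_iff [simp]: "vec x y z = vec x' y' z' \<longleftrightarrow> x = x' \<and> y = y' \<and> z = z'"
  by (metis vec_simps(2-4))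

lemma sum_indices: "(\<Sum>h<3. f h) = f i + f j + f k" for f :: "nat \<Rightarrow> nat"
  unfolding lessThan_3 using index by (simp add: add.assoc)

lemma sum_list_vec [simp]: "sum_list (vec x y z) = x + y + z"
  by (simp add: sum_list_sum_nth atLeast0LessThan sum_indices)

lemma vec_in_factorizations [simp]:
  "vec x y z \<in> factorizations ns n \<longleftrightarrow> x * ns ! i + y * ns ! j + z * ns ! k = n"
  unfolding factorizations_def evaluate_def len sum_indices by auto

lemma factorizationE:
  assumes "v \<in> factorizations ns n"
  obtains x y z where "v = vec x y z"
proof -
  have "v = vec (v ! i) (v ! j) (v ! k)"
  proof (rule nth_equalityI)
    show *: "length v = length (vec (v ! i) (v ! j) (v ! k))"
      using assms len by (simp add: factorizations_def)
    fix h
    assume "h < length v"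
    then have "h \<in> {i, j, k}"
      using * lessThan_3 by auto
    then show "v ! h = vec (v ! i) (v ! j) (v ! k) ! h"
      by auto
  qed
  then show thesis by (rule that)
qed

lemma all_indices: "(\<forall>h<3. P h) \<longleftrightarrow> P i \<and> P j \<and> P k"
proof -
  have "(\<forall>h<3. P h) \<longleftrightarrow> (\<forall>h\<in>{..<3::nat}. P h)"
    by auto
  then show ?thesis
    unfolding lessThan_3 by simp
qed

lemma pos_indices: "0 < ns ! i" "0 < ns ! j" "0 < ns ! k"
  using pos index len by simp_all

text \<open>\<open>\<alpha>\<close> copies of \<open>ns ! i\<close> and \<open>\<beta>\<close>
  copies of \<open>ns ! j\<close> both amount to the least common multiple of the two
  generators.\<close>

definition \<alpha> :: nat where "\<alpha> = ns ! j div gcd (ns ! i) (ns ! j)"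
definition \<beta> :: nat where "\<beta> = ns ! i div gcd (ns ! i) (ns ! j)"

lemma \<alpha>_\<beta>: "\<beta> * ns ! j = \<alpha> * ns ! i"
  unfolding \<alpha>_def \<beta>_def by (metis div_mult_swap gcd_dvd1 gcd_dvd2 mult.commute)

lemma \<alpha>_\<beta>_pos: "0 < \<alpha>" "0 < \<beta>"
  unfolding \<alpha>_def \<beta>_def using pos_indices by (auto simp: div_greater_zero_iff intro!: gcd_le1_nat gcd_le2_nat)

lemma \<alpha>_neq_\<beta>: "\<alpha> \<noteq> \<beta>"
proof
  assume "\<alpha> = \<beta>"
  then have "ns ! i = ns ! j"
    using \<alpha>_\<beta> \<alpha>_\<beta>_pos by auto
  then show False
    using distinct index len by (simp add: nth_eq_iff_index_eq)
qed

text \<open>The number \<open>\<tau>\<close> of trades from \<open>(x, y)\<close> to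
  \<open>(\<alpha>, 0)\<close> satisfies \<open>\<tau> * \<alpha> \<le> \<alpha>\<close>, so it is 0
  or 1.\<close>

lemma factorizations_\<alpha>_cases:
  assumes "x * ns ! i + y * ns ! j = \<alpha> * ns ! i"
  shows "(x = \<alpha> \<and> y = 0) \<or> (x = 0 \<and> y = \<beta>)"
proof (cases "x \<le> \<alpha>")
  case True
  obtain \<tau> where \<tau>: "\<alpha> = x + \<tau> * \<alpha>" "y = \<tau> * \<beta>"
    using two_generator_relation[OF pos_indices(1,2), of x y \<alpha> 0] True assms
    unfolding \<alpha>_def \<beta>_def by auto
  have "\<tau> \<le> 1"
  proof (rule ccontr)
    assume "\<not> \<tau> \<le> 1"
    then have "2 * \<alpha> \<le> \<tau> * \<alpha>"
      by (intro mult_le_mono1) simp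
    then show False
      using \<tau>(1) \<alpha>_\<beta>_pos by linarith
  qed
  then have "\<tau> = 0 \<or> \<tau> = 1"
    by linarith
  then show ?thesis
    using \<tau> by auto
next
  case False
  then have "\<alpha> * ns ! i < x * ns ! i"
    using pos_indices by simp
  then show ?thesis
    using assms by linarith
qed

lemma isolatedI:
  assumes "vec x y z \<in> factorizations ns n" and "v \<in> factorizations ns n" "v \<noteq> vec x y z"
    and "h < 3" and "\<forall>g<3. g \<noteq> h \<longrightarrow> vec x y z ! g = 0"
    and "\<And>v. v \<in> factorizations ns n \<Longrightarrow> v \<noteq> vec x y z \<Longrightarrow> v ! h = 0"
  shows "isolated ns h n"
  unfolding isolated_def len using assms by blast

lemma isolated_factorizations:
  assumes "isolated ns k b"
  obtains c where "\<And>v. v \<in> factorizations ns b \<longleftrightarrow>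
    v = vec 0 0 c \<or> (\<exists>x y. v = vec x y 0 \<and> x * ns ! i + y * ns ! j = b)"
proof -
  obtain w where w: "w \<in> factorizations ns b" "\<forall>h<3. h \<noteq> k \<longrightarrow> w ! h = 0"
    "\<forall>v\<in>factorizations ns b. v \<noteq> w \<longrightarrow> v ! k = 0"
    using assms unfolding isolated_def len by blast
  obtain x y c where "w = vec x y c"
    using factorizationE w(1) by blast
  then have wc: "w = vec 0 0 c"
    using w(2) index unfolding all_indices by auto
  show thesis
  proof (rule that[of c])
    fix v
    show "v \<in> factorizations ns b \<longleftrightarrow>
      v = vec 0 0 c \<or> (\<exists>x y. v = vec x y 0 \<and> x * ns ! i + y * ns ! j = b)"
    proof
      assume v: "v \<in> factorizations ns b"
      obtain x y z where xyz: "v = vec x y z"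
        using factorizationE v by blast
      show "v = vec 0 0 c \<or> (\<exists>x y. v = vec x y 0 \<and> x * ns ! i + y * ns ! j = b)"
      proof (cases "v = w")
        case True
        then show ?thesis using wc by simp
      next
        case False
        then have "z = 0"
          using w(3) v xyz by force
        then show ?thesis
          using xyz v by auto
      qed
    next
      assume "v = vec 0 0 c \<or> (\<exists>x y. v = vec x y 0 \<and> x * ns ! i + y * ns ! j = b)"
      then show "v \<in> factorizations ns b"
        using w(1) wc by auto
    qed
  qed
qed

text \<open>Three lengths of \<open>b\<close> leave room for a trade between \<open>ns ! i\<close>
  and \<open>ns ! j\<close>. Hence \<open>e\<close>, their least common multiple, can be split off
  from \<open>b\<close>, which makes \<open>e\<close> isolated at both \<open>i\<close> and
  \<open>j\<close> and the only possible Betti element besides \<open>b\<close>.\<close>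

lemma dense_steps_Betti_of_many_lengths:
  assumes iso: "isolated ns k b" and many: "card (length_set ns b) \<ge> 3"
    and spread: "\<And>b. b \<in> Betti ns \<Longrightarrow> spread_le D (signed_lengths ns 1 b)"
  shows "(\<forall>b\<in>Betti ns. dense_steps D (signed_lengths ns 1 b)) \<or>
    (\<forall>b\<in>Betti ns. dense_steps D (uminus ` signed_lengths ns 1 b))"
proof -
  define N where "N = {int (x + y) | x y. x * ns ! i + y * ns ! j = b}"
  define e where "e = \<alpha> * ns ! i"
  obtain c where c: "\<And>v. v \<in> factorizations ns b \<longleftrightarrow>
      v = vec 0 0 c \<or> (\<exists>x y. v = vec x y 0 \<and> x * ns ! i + y * ns ! j = b)"
    using isolated_factorizations[OF iso] by blast
  have fin: "finite (signed_lengths ns s n)" for s n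
    using finite_signed_lengths[OF pos] .
  have b: "b \<in> Betti ns"
    using iso by (rule isolated_imp_Betti)
  have lengths_b: "signed_lengths ns 1 b = insert (int c) N"
  proof (rule set_eqI)
    fix l
    have "l \<in> signed_lengths ns 1 b \<longleftrightarrow> (\<exists>v. v \<in> factorizations ns b \<and> l = int (sum_list v))"
      unfolding signed_lengths_def length_set_def by auto
    also have "\<dots> \<longleftrightarrow> l = int (sum_list (vec 0 0 c)) \<or>
        (\<exists>x y. l = int (sum_list (vec x y 0)) \<and> x * ns ! i + y * ns ! j = b)"
      unfolding c by blast
    also have "\<dots> \<longleftrightarrow> l = int c \<or> l \<in> N"
      by (simp only: N_def sum_list_vec add_0_right add_0 mem_Collect_eq)
    finally show "l \<in> signed_lengths ns 1 b \<longleftrightarrow> l \<in> insert (int c) N"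
      by simp
  qed
  then have finN: "finite N"
    using fin[of 1 b] by simp
  have card_signed: "card (signed_lengths ns 1 n) = card (length_set ns n)" for n
    unfolding signed_lengths_def by (simp add: card_image)
  have "card (insert (int c) N) \<le> Suc (card N)"
    using finN by (simp add: card_insert_if)
  \<comment> \<open>At most one of the three lengths is due to the isolated factorization, so two
    come from \<open>ns ! i\<close> and \<open>ns ! j\<close> alone.\<close>
  then have "\<not> card N \<le> Suc 0"
    using many card_signed[of b] unfolding lengths_b by linarith
  then obtain l l' where "l \<in> N" "l' \<in> N" "l \<noteq> l'"
    unfolding card_le_Suc0_iff_eq[OF finN] by blast
  then have "\<exists>x y x' y'. x * ns ! i + y * ns ! j = b \<and> x' * ns ! i + y' * ns ! j = b
      \<and> x + y \<noteq> x' + y'"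
    unfolding N_def mem_Collect_eq by metis
  then obtain x y x' y' where xy: "x * ns ! i + y * ns ! j = b" "x' * ns ! i + y' * ns ! j = b"
    "x + y \<noteq> x' + y'" "x \<le> x'"
    by (metis nle_le)
  obtain \<tau> where \<tau>: "x' = x + \<tau> * \<alpha>" "y = y' + \<tau> * \<beta>"
    using two_generator_relation[OF pos_indices(1,2), of x y x' y'] xy
    unfolding \<alpha>_def \<beta>_def by auto
  have "\<tau> \<noteq> 0"
    using \<tau> xy(3) by auto
  then have "\<alpha> \<le> x'"
    using \<tau>(1) by (cases \<tau>) auto
  then obtain d where d: "x' = d + \<alpha>"
    using le_Suc_ex[of \<alpha> x'] by (auto simp: add.commute)
  have b_e: "b = d * ns ! i + y' * ns ! j + e"
    using xy(2) unfolding d e_def by (simp add: algebra_simps)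
  \<comment> \<open>A factorization of \<open>e\<close> that uses \<open>ns ! k\<close> extends by
    \<open>d\<close> and \<open>y'\<close> to one of \<open>b\<close> that is positive at
    \<open>k\<close>. It must be \<open>vec 0 0 c\<close>, so \<open>d = y' = 0\<close> and
    \<open>e = b\<close>.\<close>
  have fact_e: "v = vec \<alpha> 0 0 \<or> v = vec 0 \<beta> 0 \<or> (e = b \<and> v = vec 0 0 c)"
    if mem: "v \<in> factorizations ns e" for v
  proof -
    obtain p q z where v: "v = vec p q z"
      using factorizationE mem by blast
    then have eq: "p * ns ! i + q * ns ! j + z * ns ! k = e"
      using mem by simp
    show ?thesis
    proof (cases "z = 0")
      case True
      then show ?thesis
        using factorizations_\<alpha>_cases[of p q] eq v unfolding e_def by auto
    next
      case False
      have "vec (d + p) (y' + q) z \<in> factorizations ns b"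
        using b_e eq by (simp add: algebra_simps)
      then have "vec (d + p) (y' + q) z = vec 0 0 c"
        using c False by auto
      then show ?thesis
        using v b_e by auto
    qed
  qed
  have mem_e: "vec \<alpha> 0 0 \<in> factorizations ns e" "vec 0 \<beta> 0 \<in> factorizations ns e"
    unfolding e_def by (simp_all add: \<alpha>_\<beta>)
  have iso_i: "isolated ns i e"
  proof (rule isolatedI[OF mem_e])
    show "v ! i = 0" if "v \<in> factorizations ns e" "v \<noteq> vec \<alpha> 0 0" for v
      using fact_e[OF that(1)] that(2) by auto
  qed (use index \<alpha>_\<beta>_pos in \<open>auto simp: all_indices\<close>)
  have iso_j: "isolated ns j e"
  proof (rule isolatedI[OF mem_e(2,1)])
    show "v ! j = 0" if "v \<in> factorizations ns e" "v \<noteq> vec 0 \<beta> 0" for v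
      using fact_e[OF that(1)] that(2) by auto
  qed (use index \<alpha>_\<beta>_pos in \<open>auto simp: all_indices\<close>)
  have e: "e \<in> Betti ns"
    using iso_i by (rule isolated_imp_Betti)
  \<comment> \<open>Every Betti element is isolated at one of \<open>i\<close>, \<open>j\<close>,
    \<open>k\<close>, and each index admits only one.\<close>
  have Betti: "b' = b \<or> b' = e" if b': "b' \<in> Betti ns" for b'
  proof -
    obtain h where "h < 3" "isolated ns h b'"
      using Betti_imp_isolated[OF len pos b'] by blast
    moreover have "h \<in> {i, j, k}"
      using \<open>h < 3\<close> lessThan_3 by auto
    ultimately show ?thesis
      using isolated_unique[OF pos] iso iso_i iso_j index len by auto
  qed
  show ?thesis
  proof (cases "e = b")
    case True
    have sub: "signed_lengths ns 1 b \<subseteq> {int \<alpha>, int \<beta>, int c}"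
      using fact_e unfolding True signed_lengths_def length_set_def by fastforce
    moreover have "card {int \<alpha>, int \<beta>, int c} \<le> 3"
      by (intro card_insert_le_m1) auto
    ultimately have eq: "signed_lengths ns 1 b = {int \<alpha>, int \<beta>, int c}"
      using many card_signed[of b] by (intro card_seteq) auto
    then have "card {int \<alpha>, int \<beta>, int c} \<ge> 3"
      using many card_signed[of b] by simp
    then have "int \<alpha> \<noteq> int \<beta>" "int \<alpha> \<noteq> int c" "int \<beta> \<noteq> int c"
      by (auto simp: card_insert_if split: if_splits)
    then show ?thesis
      using dense_steps_three spread[OF b] Betti unfolding eq True by (metis eq)
  next
    case False
    have "signed_lengths ns 1 e = (\<lambda>v. int (sum_list v)) ` factorizations ns e"
      unfolding signed_lengths_def length_set_def by (auto simp: image_image)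
    also have "factorizations ns e = {vec \<alpha> 0 0, vec 0 \<beta> 0}"
      using fact_e mem_e False by blast
    finally have lengths_e: "signed_lengths ns 1 e = {int \<alpha>, int \<beta>}"
      by simp
    \<comment> \<open>The two lengths of \<open>e\<close> differ by exactly the trade step of
      \<open>N\<close>, so the spread bound at \<open>e\<close> bounds that step by
      \<open>D\<close>.\<close>
    have "real_of_int \<bar>int \<alpha> - int \<beta>\<bar> \<le> D"
      using spread[OF e] \<alpha>_neq_\<beta> unfolding lengths_e spread_le_def by auto
    moreover have "linked \<bar>int \<alpha> - int \<beta>\<bar> N"
      unfolding \<alpha>_def \<beta>_def N_def by (rule linked_two_generator_lengths[OF pos_indices(1,2)])
    moreover have "N \<noteq> {}"
      using \<open>l \<in> N\<close> by blast
    ultimately have "dense_steps D (insert (int c) N) \<or> dense_steps D (uminus ` insert (int c) N)"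
      using finN spread[OF b] unfolding lengths_b by (intro dense_steps_insert)
    moreover have "dense_steps D (signed_lengths ns 1 e)"
      "dense_steps D (uminus ` signed_lengths ns 1 e)"
      using spread[OF e] spread_le_uminus[OF spread[OF e]] unfolding lengths_e
      by (auto intro!: dense_steps_card_le_2 simp: card_insert_if)
    ultimately show ?thesis
      using Betti lengths_b by (metis (no_types, lifting))
  qed
qed

end

context three_generators
begin

lemma other_indices:
  assumes "k < 3"
  obtains i j where "three_generators_indexed ns i j k"
proof -
  have "k = 0 \<or> k = 1 \<or> k = 2"
    using assms by linarith
  then have "\<exists>i j. i < 3 \<and> j < 3 \<and> i \<noteq> j \<and> i \<noteq> k \<and> j \<noteq> k"
  proof (elim disjE)
    show ?thesis if "k = 0"
      using that by (intro exI[of _ 1] exI[of _ 2]) auto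
    show ?thesis if "k = 1"
      using that by (intro exI[of _ 0] exI[of _ 2]) auto
    show ?thesis if "k = 2"
      using that by (intro exI[of _ 0] exI[of _ 1]) auto
  qed
  then show thesis
    using that assms three_generators_axioms
    unfolding three_generators_indexed_def three_generators_indexed_axioms_def by blast
qed

text \<open>One direction must serve all Betti elements at once, since the induction keeps its sign
  fixed. If all have at most two lengths, the upward one works; otherwise an element with three
  lengths determines it.\<close>

lemma spread_le_of_Betti:
  assumes D: "D \<ge> 0" and spread: "\<And>b. b \<in> Betti ns \<Longrightarrow> spread_le D (signed_lengths ns 1 b)"
  shows "spread_le D (signed_lengths ns 1 n)"
proof -
  have fin: "finite (signed_lengths ns s n)" for s n
    using finite_signed_lengths[OF pos] .
  have uminus: "signed_lengths ns (- 1) n = uminus ` signed_lengths ns 1 n" for n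
    unfolding signed_lengths_def by (simp add: image_image)
  have "(\<forall>b\<in>Betti ns. dense_steps D (signed_lengths ns 1 b)) \<or>
    (\<forall>b\<in>Betti ns. dense_steps D (signed_lengths ns (- 1) b))"
  proof (cases "\<exists>b\<in>Betti ns. card (length_set ns b) \<ge> 3")
    case True
    then obtain b where b: "b \<in> Betti ns" "card (length_set ns b) \<ge> 3"
      by blast
    obtain k where k: "k < 3" "isolated ns k b"
      using Betti_imp_isolated[OF len pos b(1)] by blast
    obtain i j where "three_generators_indexed ns i j k"
      using other_indices[OF k(1)] by blast
    then show ?thesis
      using three_generators_indexed.dense_steps_Betti_of_many_lengths k(2) b(2) spread
      unfolding uminus by blast
  next
    case False
    have "card (signed_lengths ns 1 b) \<le> 2" if "b \<in> Betti ns" for b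
      using False that unfolding signed_lengths_def by (fastforce simp: card_image)
    then show ?thesis
      using fin spread by (intro disjI1 ballI dense_steps_card_le_2)
  qed
  then show ?thesis
  proof (elim disjE)
    assume "\<forall>b\<in>Betti ns. dense_steps D (signed_lengths ns 1 b)"
    then have "dense_steps D (signed_lengths ns 1 n)"
      using dense_steps_of_Betti[OF pos D] by blast
    then show ?thesis
      using fin D by (intro dense_steps_imp_spread_le)
  next
    assume "\<forall>b\<in>Betti ns. dense_steps D (signed_lengths ns (- 1) b)"
    then have "dense_steps D (signed_lengths ns (- 1) n)"
      using dense_steps_of_Betti[OF pos D] by blast
    then have "spread_le D (signed_lengths ns (- 1) n)"
      using fin D by (intro dense_steps_imp_spread_le)
    then have "spread_le D (uminus ` signed_lengths ns (- 1) n)"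
      by (rule spread_le_uminus)
    then show ?thesis
      unfolding uminus by (simp add: image_image)
  qed
qed

section \<open>The infimum as a minimum over Betti elements\<close>

lemma finite_Betti: "finite (Betti ns)"
proof -
  have "finite {b. isolated ns k b}" if "k < 3" for k
  proof (cases "\<exists>b. isolated ns k b")
    case True
    then obtain b where "isolated ns k b"
      by blast
    then have "{b. isolated ns k b} \<subseteq> {b}"
      using isolated_unique[OF pos] that len by auto
    then show ?thesis
      using finite_subset by blast
  qed simp
  then have "finite (\<Union>k<3. {b. isolated ns k b})"
    by blast
  moreover have "Betti ns \<subseteq> (\<Union>k<3. {b. isolated ns k b})"
    using Betti_imp_isolated[OF len pos] by blast
  ultimately show ?thesis
    by (rule rev_finite_subset)
qed

lemma spread_le_signed_lengths:
  "spread_le D (signed_lengths ns 1 n) \<longleftrightarrow> (\<forall>l\<in>length_set ns n. \<forall>u\<in>length_set ns n.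
     real u - real l \<le> D * (real (card (length_set ns n)) - 1))"
  unfolding spread_le_def signed_lengths_def by (simp add: card_image)

lemma length_range_pos:
  assumes "card (length_set ns n) \<ge> 2"
  shows "Min (length_set ns n) < Max (length_set ns n)"
proof (rule ccontr)
  let ?L = "length_set ns n"
  have fin: "finite ?L"
    using pos by (rule finite_length_set)
  assume "\<not> Min ?L < Max ?L"
  then have "x = Min ?L" if "x \<in> ?L" for x
    using Max_ge[OF fin that] Min_le[OF fin that] by linarith
  then have "?L \<subseteq> {Min ?L}"
    by blast
  then have "card ?L \<le> card {Min ?L}"
    by (intro card_mono) auto
  then show False
    using assms by simp
qed

text \<open>Only the extreme lengths matter in \<open>spread_le\<close>; for them the inequality
  rearranges to the density bound.\<close>

lemma spread_le_iff_length_density_at: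
  assumes card: "card (length_set ns n) \<ge> 2" and \<delta>: "\<delta> > 0"
  shows "spread_le (1 / \<delta>) (signed_lengths ns 1 n) \<longleftrightarrow> \<delta> \<le> length_density_at ns n"
proof -
  let ?L = "length_set ns n"
  have fin: "finite ?L"
    using pos by (rule finite_length_set)
  have ne: "?L \<noteq> {}"
    using card by auto
  have "spread_le (1 / \<delta>) (signed_lengths ns 1 n) \<longleftrightarrow>
    real (Max ?L) - real (Min ?L) \<le> 1 / \<delta> * (real (card ?L) - 1)"
    unfolding spread_le_signed_lengths
  proof (intro iffI ballI)
    fix l u
    assume le: "real (Max ?L) - real (Min ?L) \<le> 1 / \<delta> * (real (card ?L) - 1)"
      and "l \<in> ?L" "u \<in> ?L"
    then have "Min ?L \<le> l" "u \<le> Max ?L"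
      using fin by auto
    then show "real u - real l \<le> 1 / \<delta> * (real (card ?L) - 1)"
      using le by linarith
  qed (use Max_in[OF fin ne] Min_in[OF fin ne] in blast)
  also have "\<dots> \<longleftrightarrow> \<delta> \<le> length_density_at ns n"
    unfolding length_density_at_def using length_range_pos[OF card] \<delta>
    by (simp add: field_simps)
  finally show ?thesis .
qed

text \<open>The witness is the least common multiple of two generators: its factorizations by either
  one alone have different lengths, as the generators differ.\<close>

lemma ex_two_lengths: "\<exists>n\<in>semigroup_of ns. card (length_set ns n) \<ge> 2"
proof -
  obtain i j where "three_generators_indexed ns i j 2"
    using other_indices[of 2] by auto
  then interpret three_generators_indexed ns i j 2 .
  let ?n = "\<alpha> * ns ! i"
  have mem: "vec \<alpha> 0 0 \<in> factorizations ns ?n" "vec 0 \<beta> 0 \<in> factorizations ns ?n"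
    using \<alpha>_\<beta> by simp_all
  then have "{\<alpha>, \<beta>} \<subseteq> length_set ns ?n"
    unfolding length_set_def by (metis (mono_tags) add_0 add_0_right empty_subsetI image_eqI
        insert_subset sum_list_vec)
  then have "card {\<alpha>, \<beta>} \<le> card (length_set ns ?n)"
    using finite_length_set[OF pos] by (intro card_mono)
  then show ?thesis
    using \<alpha>_neq_\<beta> mem(1) by (intro bexI[of _ ?n]) (auto simp: factorizations_def semigroup_of_def)
qed

text \<open>The least density \<open>\<delta>\<close> over \<open>B\<close> gives the spread bound
  with \<open>D = 1 / \<delta>\<close> at every Betti element, hence at every element. So
  \<open>\<delta>\<close> is a lower bound that is attained.\<close>

theorem length_density_at_Betti:
  "\<exists>b\<in>Betti ns. card (length_set ns b) \<ge> 2 \<and> length_density_at ns b = length_density ns"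
proof -
  define B where "B = {b \<in> Betti ns. card (length_set ns b) \<ge> 2}"
  have fin: "finite B"
    unfolding B_def using finite_Betti by simp
  have spread_small: "spread_le D (signed_lengths ns 1 b)"
    if "\<not> card (length_set ns b) \<ge> 2" for D b
  proof -
    let ?L = "length_set ns b"
    have fin: "finite ?L"
      using pos by (rule finite_length_set)
    have "real u - real l \<le> D * (real (card ?L) - 1)" if "l \<in> ?L" "u \<in> ?L" for l u
    proof -
      have "card ?L > 0"
        using fin that by (auto simp: card_gt_0_iff)
      then have 1: "card ?L = 1"
        using \<open>\<not> card ?L \<ge> 2\<close> by linarith
      then have "l = u"
        using that by (auto simp: card_1_singleton_iff)
      then show ?thesis
        using 1 by simp
    qed
    then show ?thesis
      unfolding spread_le_signed_lengths by blast
  qed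
  obtain n where n: "card (length_set ns n) \<ge> 2"
    using ex_two_lengths by blast
  \<comment> \<open>If \<open>B\<close> were empty, the spread bound would hold with
    \<open>D = 0\<close> at every Betti element and hence everywhere, so no element would have two
    lengths.\<close>
  have "B \<noteq> {}"
  proof
    assume "B = {}"
    then have "spread_le 0 (signed_lengths ns 1 n)"
      using spread_le_of_Betti[of 0 n] spread_small unfolding B_def by blast
    moreover have "length_set ns n \<noteq> {}"
      using n by auto
    then have "Max (length_set ns n) \<in> length_set ns n" "Min (length_set ns n) \<in> length_set ns n"
      using finite_length_set[OF pos] by (auto intro: Max_in Min_in)
    ultimately have "real (Max (length_set ns n)) - real (Min (length_set ns n)) \<le> 0"
      unfolding spread_le_signed_lengths by fastforce
    then show False
      using length_range_pos[OF n] by simp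
  qed
  define \<delta> where "\<delta> = Min (length_density_at ns ` B)"
  have "\<delta> \<in> length_density_at ns ` B"
    unfolding \<delta>_def using fin \<open>B \<noteq> {}\<close> by (intro Min_in) auto
  then obtain b where b: "b \<in> B" "\<delta> = length_density_at ns b"
    by blast
  have card_b: "card (length_set ns b) \<ge> 2"
    using b(1) unfolding B_def by simp
  have \<delta>: "\<delta> > 0"
    unfolding b(2) length_density_at_def using card_b length_range_pos[OF card_b] by simp
  have spread: "spread_le (1 / \<delta>) (signed_lengths ns 1 m)" for m
  proof (rule spread_le_of_Betti)
    fix a
    assume a: "a \<in> Betti ns"
    show "spread_le (1 / \<delta>) (signed_lengths ns 1 a)"
    proof (cases "card (length_set ns a) \<ge> 2")
      case True
      then have "\<delta> \<le> length_density_at ns a"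
        unfolding \<delta>_def using fin a by (intro Min_le) (auto simp: B_def)
      then show ?thesis
        using spread_le_iff_length_density_at[OF True \<delta>] by simp
    next
      case False
      then show ?thesis by (rule spread_small)
    qed
  qed (use \<delta> in simp)
  have "length_density ns = \<delta>"
    unfolding length_density_def
  proof (rule cInf_eq_minimum)
    show "\<delta> \<in> {length_density_at ns n | n. n \<in> semigroup_of ns \<and> card (length_set ns n) \<ge> 2}"
      using b card_b unfolding B_def Betti_def mem_Collect_eq by (intro exI[of _ b]) simp
  next
    fix x
    assume "x \<in> {length_density_at ns n | n. n \<in> semigroup_of ns \<and> card (length_set ns n) \<ge> 2}"
    then show "\<delta> \<le> x"
      using spread spread_le_iff_length_density_at \<delta> by blast
  qed
  then show ?thesis
    using b card_b unfolding B_def by (intro bexI[of _ b]) auto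
qed

end

section \<open>Positive and distinct generators from minimality\<close>

lemma semigroup_of_two: "semigroup_of [a, b] = {x * a + y * b | x y. True}"
proof (intro set_eqI iffI)
  fix n
  assume "n \<in> {x * a + y * b | x y. True}"
  then obtain x y where "n = x * a + y * b"
    by blast
  then show "n \<in> semigroup_of [a, b]"
    unfolding semigroup_of_def evaluate_def
    by (intro CollectI exI[of _ "[x, y]"]) (simp add: numeral_2_eq_2)
qed (auto simp: semigroup_of_def evaluate_def numeral_2_eq_2)

lemma semigroup_of_three: "semigroup_of [a, b, c] = {x * a + y * b + z * c | x y z. True}"
proof (intro set_eqI iffI)
  fix n
  assume "n \<in> {x * a + y * b + z * c | x y z. True}"
  then obtain x y z where "n = x * a + y * b + z * c"
    by blast
  then show "n \<in> semigroup_of [a, b, c]"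
    unfolding semigroup_of_def evaluate_def
    by (intro CollectI exI[of _ "[x, y, z]"]) (simp add: eval_nat_numeral)
qed (auto simp: semigroup_of_def evaluate_def eval_nat_numeral)

lemma semigroup_of_drop_redundant:
  assumes "a = p * b + q * c"
  shows "semigroup_of [a, b, c] = semigroup_of [b, c]"
proof (intro set_eqI iffI)
  fix n
  assume "n \<in> semigroup_of [a, b, c]"
  then obtain x y z where "n = x * a + y * b + z * c"
    unfolding semigroup_of_three by blast
  then have "n = (x * p + y) * b + (x * q + z) * c"
    unfolding assms by (simp add: algebra_simps)
  then show "n \<in> semigroup_of [b, c]"
    unfolding semigroup_of_two by blast
next
  fix n
  assume "n \<in> semigroup_of [b, c]"
  then obtain y z where "n = 0 * a + y * b + z * c"
    unfolding semigroup_of_two by auto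
  then show "n \<in> semigroup_of [a, b, c]"
    unfolding semigroup_of_three by blast
qed

lemma semigroup_of_swap:
  "semigroup_of [a, b, c] = semigroup_of [b, a, c]"
  "semigroup_of [a, b, c] = semigroup_of [c, a, b]"
proof -
  have "n = x * a + y * b + z * c \<longleftrightarrow> n = y * b + x * a + z * c"
    "n = x * a + y * b + z * c \<longleftrightarrow> n = z * c + x * a + y * b" for n x y z
    by auto
  then show "semigroup_of [a, b, c] = semigroup_of [b, a, c]"
    "semigroup_of [a, b, c] = semigroup_of [c, a, b]"
    unfolding semigroup_of_three by blast+
qed

text \<open>A generator that is zero or equal to another one is a combination of the other two with
  coefficients 0 and 1, so it could be dropped.\<close>

lemma minimally_generated_by_three:
  assumes "minimally_generated_by S [a, b, c]"
  shows "three_generators [a, b, c]"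
proof -
  have S: "S = semigroup_of [a, b, c]"
    and min: "\<And>i. i < 3 \<Longrightarrow> semigroup_of (take i [a, b, c] @ drop (Suc i) [a, b, c]) \<noteq> S"
    using assms unfolding minimally_generated_by_def by auto
  have a: "a \<noteq> p * b + q * c" for p q
    using min[of 0] semigroup_of_drop_redundant[of a p b q c] S by auto
  have b: "b \<noteq> p * a + q * c" for p q
    using min[of 1] semigroup_of_drop_redundant[of b p a q c] S semigroup_of_swap(1)[of a b c]
    by auto
  have c: "c \<noteq> p * a + q * b" for p q
    using min[of 2] semigroup_of_drop_redundant[of c p a q b] S semigroup_of_swap(2)[of a b c]
    by (auto simp: eval_nat_numeral)
  have "a \<noteq> 0" "b \<noteq> 0" "c \<noteq> 0" "a \<noteq> b" "a \<noteq> c" "b \<noteq> c"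
    using a[of 0 0] b[of 0 0] c[of 0 0] a[of 1 0] a[of 0 1] b[of 0 1] by auto
  then show ?thesis
    by unfold_locales (auto simp: less_Suc_eq)
qed

theorem theorem4p5:
  fixes S :: "nat set" and n1 n2 n3 :: nat
  assumes "minimally_generated_by S [n1, n2, n3]"
  shows "\<exists>b\<in>Betti [n1, n2, n3].
           card (length_set [n1, n2, n3] b) \<ge> 2 \<and>
           length_density_at [n1, n2, n3] b = length_density [n1, n2, n3]"
  using minimally_generated_by_three[OF assms] by (rule three_generators.length_density_at_Betti)

end
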